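(* Consider the ideal $\mathfrak{m}:=\langle x,y,z^2+1\rangle\subset\mathbb{R}[x,y,z]$. The polynomial $$f:=x^{10}+x^2y^6+(z^2+1)^3-3x^4y^2(z^2+1)$$ is positive semidefinite. It is a sum of squares in $\mathbb{R}[x,y,z]_{\mathfrak{p}}$ for all prime ideals $\mathfrak{p}\subset\mathbb{R}[x,y,z]$ distinct from $\mathfrak{m}$, but it is not a sum of squares in $\mathbb{R}[x,y,z]_{\mathfrak{m}}$.
   Context: A polynomial $f\in\mathbb{R}[x,y,z]$ is positive semidefinite if $f(a)\geq 0$ for all $a\in\mathbb{R}^3$. For a prime ideal $\mathfrak{p}$, $\mathbb{R}[x,y,z]_{\mathfrak{p}}$ denotes the localization at $\mathfrak{p}$. Sums of squares are finite. *)

theory Defs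
  imports
    "HOL-Algebra.Algebraic_Closure_Type"
    "HOL-Algebra.Ideal"
    "HOL-Computational_Algebra.Polynomial"
    "HOL-Computational_Algebra.Fraction_Field"
begin

(* R[x,y,z] is represented as R[x][y][z]: the innermost poly is in x, the outermost in z. *)
type_synonym poly_xyz = "real poly poly poly"

definition var_x :: poly_xyz where "var_x = [:[:[:0, 1:]:]:]"
definition var_y :: poly_xyz where "var_y = [:[:0, 1:]:]"
definition var_z :: poly_xyz where "var_z = [:0, 1:]"

definition eval_xyz :: "poly_xyz \<Rightarrow> real \<Rightarrow> real \<Rightarrow> real \<Rightarrow> real" where
  "eval_xyz g a b c = poly (poly (poly g [:[:c:]:]) [:b:]) a"

definition psd :: "poly_xyz \<Rightarrow> bool" where
  "psd g \<longleftrightarrow> (\<forall>a b c. eval_xyz g a b c \<ge> 0)"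

(* HOL-Algebra's notions of ideal apply to record rings; this is R[x,y,z] as such a record. *)
abbreviation ring_xyz :: "poly_xyz ring" where
  "ring_xyz \<equiv> ring_of_type_algebra"

(* The localization of an integral domain at a prime ideal P, as a subring of the
   fraction field. It is meaningful only for prime P, so that 0 is never a denominator. *)
definition localization :: "'a::idom set \<Rightarrow> 'a fract set" where
  "localization P = {Fract g h | g h. h \<notin> P}"

(* S is the carrier of a subring; the squared elements must themselves lie in S. *)
definition sum_of_squares_in :: "'a::comm_ring_1 set \<Rightarrow> 'a \<Rightarrow> bool" where
  "sum_of_squares_in S a \<longleftrightarrow> (\<exists>qs. set qs \<subseteq> S \<and> a = (\<Sum>q\<leftarrow>qs. q\<^sup>2))"

definition ideal_m :: "poly_xyz set" where
  "ideal_m = Idl\<^bsub>ring_xyz\<^esub> {var_x, var_y, var_z\<^sup>2 + 1}"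

definition poly_f :: poly_xyz where
  "poly_f = var_x ^ 10 + var_x\<^sup>2 * var_y ^ 6 + (var_z\<^sup>2 + 1) ^ 3
     - 3 * var_x ^ 4 * var_y\<^sup>2 * (var_z\<^sup>2 + 1)"

end

theory Submission
  imports Defs
begin

text \<open>
  Write \<open>u = x\<^sup>2\<close>, \<open>v = y\<^sup>2\<close>, \<open>w = z\<^sup>2 + 1\<close>, all three of which are sums of squares, so that
  \<open>f = u\<^sup>5 + u v\<^sup>3 + w\<^sup>3 - 3 u\<^sup>2 v w\<close>.  This is \<open>a\<^sup>3 + b\<^sup>3 + c\<^sup>3 - 3 a b c\<close> for
  \<open>a = u\<^bsup>5/3\<^esup>\<close>, \<open>b = u\<^bsup>1/3\<^esup> v\<close>, \<open>c = w\<close>, hence nonnegative by the inequality between the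
  arithmetic and the geometric mean.

  \<^emph>\<open>Away from \<open>\<mm>\<close>.\<close>  The identity
  \<open>(c\<^sup>2 + a b) (a\<^sup>3 + b\<^sup>3 + c\<^sup>3 - 3 a b c) = c (c\<^sup>2 - a b)\<^sup>2 + a (b\<^sup>2 - a c)\<^sup>2 + b (a\<^sup>2 - b c)\<^sup>2\<close>
  and its two cyclic variants lose their fractional exponents after a suitable power of
  \<open>u\<^bsup>1/3\<^esup>\<close> is cancelled.  They show that \<open>f\<close> becomes a sum of squares when multiplied by
  \<open>w\<^sup>2 + u\<^sup>2 v\<close>, by \<open>u\<^sup>3 + v w\<close> or by \<open>v\<^sup>2 + u w\<close>.  These multipliers still have the complex curve
  \<open>(u, v, w) = (\<tau>\<^sup>3, \<tau>\<^sup>4, - \<tau>\<^sup>5)\<close> in common; a fourth multiplier,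
  \<open>w\<^sup>4 + w\<^sup>2 u\<^sup>2 v + 16 u\<^sup>4 v\<^sup>2\<close>, does not vanish on that curve except at \<open>\<tau> = 0\<close>.  A prime ideal
  that contains all four contains \<open>x\<close>, \<open>y\<close> and \<open>w\<close>, and so is \<open>\<mm>\<close>.  For every other
  prime, one of the multipliers \<open>s\<close> is a unit of the localization, and \<open>f = s (s f) / s\<^sup>2\<close> is a
  sum of squares there.

  \<^emph>\<open>At \<open>\<mm>\<close>.\<close>  Suppose that \<open>h\<^sup>2 f = \<Sum> q\<^sub>i\<^sup>2\<close> with \<open>h \<notin> \<mm>\<close>.  Every \<open>q\<^sub>i\<close> vanishes at the real
  zeros of \<open>f\<close>, in particular at all points \<open>(t\<^sup>3, \<plusminus>t\<^sup>4, z)\<close> with \<open>z\<^sup>2 + 1 = t\<^sup>1\<^sup>0\<close>.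
  Their Zariski closure is a pair of curves that both run through the complex points
  \<open>(0, 0, \<plusminus>\<i>)\<close> of \<open>\<mm>\<close>, and a polynomial that vanishes on both vanishes to
  second order there: the only relation with a linear term is \<open>w = x\<^sup>2 y\<close> on the first curve and
  \<open>w = - x\<^sup>2 y\<close> on the second, and these are incompatible.  Restricted to the line
  \<open>x = y = 0\<close>, each \<open>q\<^sub>i\<close> is therefore divisible by \<open>w\<^sup>2\<close>, whereas \<open>f\<close> restricts to \<open>w\<^sup>3\<close>.  So
  \<open>w\<^sup>4\<close> divides \<open>w\<^sup>3 h(0, 0, z)\<^sup>2\<close>, which forces \<open>h(0, 0, \<i>) = 0\<close>, that is, \<open>h \<in> \<mm>\<close>.
\<close>

section \<open>Sums of squares\<close>

lemma sum_of_squares_0: "sum_of_squares_in UNIV 0"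
  unfolding sum_of_squares_in_def by (intro exI[of _ "[]"]) simp

lemma sum_of_squares_square: "sum_of_squares_in UNIV (a\<^sup>2)"
  unfolding sum_of_squares_in_def by (intro exI[of _ "[a]"]) simp

lemma sum_of_squares_1: "sum_of_squares_in UNIV 1"
  using sum_of_squares_square[of 1] by simp

lemma sum_of_squares_add:
  assumes "sum_of_squares_in UNIV a" "sum_of_squares_in UNIV b"
  shows "sum_of_squares_in UNIV (a + b)"
proof -
  obtain as bs where "a = (\<Sum>q\<leftarrow>as. q\<^sup>2)" "b = (\<Sum>q\<leftarrow>bs. q\<^sup>2)"
    using assms unfolding sum_of_squares_in_def by auto
  then show ?thesis
    unfolding sum_of_squares_in_def by (intro exI[of _ "as @ bs"]) simp
qed

lemma sum_of_squares_square_mult: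
  assumes "sum_of_squares_in UNIV b"
  shows "sum_of_squares_in UNIV (a\<^sup>2 * b)"
proof -
  obtain bs where bs: "b = (\<Sum>q\<leftarrow>bs. q\<^sup>2)"
    using assms unfolding sum_of_squares_in_def by auto
  have "a\<^sup>2 * b = (\<Sum>q\<leftarrow>map ((*) a) bs. q\<^sup>2)"
    unfolding bs by (induction bs) (auto simp: algebra_simps power_mult_distrib)
  then show ?thesis
    unfolding sum_of_squares_in_def by blast
qed

lemma sum_of_squares_mult:
  assumes "sum_of_squares_in UNIV a" "sum_of_squares_in UNIV b"
  shows "sum_of_squares_in UNIV (a * b)"
proof -
  obtain as where as: "a = (\<Sum>q\<leftarrow>as. q\<^sup>2)"
    using assms unfolding sum_of_squares_in_def by auto
  show ?thesis
    unfolding as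
    by (induction as)
       (auto simp: distrib_right sum_of_squares_0 assms(2)
             intro!: sum_of_squares_add sum_of_squares_square_mult)
qed

lemma sum_of_squares_power:
  assumes "sum_of_squares_in UNIV a"
  shows "sum_of_squares_in UNIV (a ^ n)"
  by (induction n) (auto intro: sum_of_squares_1 sum_of_squares_mult assms)

lemma sum_of_squares_numeral: "sum_of_squares_in UNIV (numeral n)"
proof -
  have "sum_of_squares_in UNIV (of_nat k)" for k :: nat
    by (induction k) (auto intro: sum_of_squares_0 sum_of_squares_1 sum_of_squares_add)
  from this[of "numeral n"] show ?thesis by simp
qed

section \<open>Clearing denominators in a localization\<close>

text \<open>
  Since \<open>f = s (s f) / s\<^sup>2\<close>, and both \<open>s\<close> and \<open>s f\<close> are sums of squares, so is the numerator.
\<close>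

lemma sum_of_squares_in_localization:
  fixes s f :: "'a::idom"
  assumes "0 \<in> P" "s \<notin> P" "sum_of_squares_in UNIV s" "sum_of_squares_in UNIV (s * f)"
  shows "sum_of_squares_in (localization P) (Fract f 1)"
proof -
  have "s \<noteq> 0" using assms(1,2) by auto
  obtain qs where qs: "s * (s * f) = (\<Sum>q\<leftarrow>qs. q\<^sup>2)"
    using sum_of_squares_mult[OF assms(3,4)] unfolding sum_of_squares_in_def by auto
  have "(\<Sum>q\<leftarrow>map (\<lambda>q. Fract q s) qs. q\<^sup>2) = Fract (\<Sum>q\<leftarrow>qs. q\<^sup>2) (s\<^sup>2)"
    using \<open>s \<noteq> 0\<close>
    by (induction qs) (auto simp: power2_eq_square eq_fract Zero_fract_def algebra_simps)
  also have "\<dots> = Fract f 1"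
    unfolding qs[symmetric] using \<open>s \<noteq> 0\<close>
    by (simp add: eq_fract power2_eq_square algebra_simps)
  finally have "Fract f 1 = (\<Sum>q\<leftarrow>map (\<lambda>q. Fract q s) qs. q\<^sup>2)" ..
  moreover have "set (map (\<lambda>q. Fract q s) qs) \<subseteq> localization P"
    using \<open>s \<notin> P\<close> unfolding localization_def by auto
  ultimately show ?thesis
    unfolding sum_of_squares_in_def by blast
qed

lemma clear_denominators:
  fixes f :: "'a::idom"
  assumes "0 \<in> P" "1 \<notin> P" and prime: "\<And>a b. a * b \<in> P \<Longrightarrow> a \<in> P \<or> b \<in> P"
    and "sum_of_squares_in (localization P) (Fract f 1)"
  obtains h ps where "h \<notin> P" "h\<^sup>2 * f = (\<Sum>p\<leftarrow>ps. p\<^sup>2)"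
proof -
  obtain qs where "set qs \<subseteq> localization P" and f: "Fract f 1 = (\<Sum>q\<leftarrow>qs. q\<^sup>2)"
    using assms(4) unfolding sum_of_squares_in_def by auto
  from this(1) have "\<exists>h ps. h \<notin> P \<and> Fract (h\<^sup>2) 1 * (\<Sum>q\<leftarrow>qs. q\<^sup>2) = Fract (\<Sum>p\<leftarrow>ps. p\<^sup>2) 1"
  proof (induction qs)
    case Nil
    then show ?case
      using assms(2) by (intro exI[of _ 1] exI[of _ "[]"]) (simp add: Zero_fract_def)
  next
    case (Cons q qs)
    then obtain h ps where h: "h \<notin> P"
      and ps: "Fract (h\<^sup>2) 1 * (\<Sum>q\<leftarrow>qs. q\<^sup>2) = Fract (\<Sum>p\<leftarrow>ps. p\<^sup>2) 1" by auto
    obtain g k where q: "q = Fract g k" and k: "k \<notin> P"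
      using Cons.prems unfolding localization_def by auto
    have "k \<noteq> 0" using k assms(1) by auto
    have "Fract ((k * h)\<^sup>2) 1 * (\<Sum>q\<leftarrow>q # qs. q\<^sup>2)
        = Fract ((k * h)\<^sup>2) 1 * q\<^sup>2 + Fract (k\<^sup>2) 1 * (Fract (h\<^sup>2) 1 * (\<Sum>q\<leftarrow>qs. q\<^sup>2))"
      by (simp add: distrib_left power_mult_distrib mult.assoc[symmetric])
    also have "\<dots> = Fract ((g * h)\<^sup>2 + k\<^sup>2 * (\<Sum>p\<leftarrow>ps. p\<^sup>2)) 1"
      using \<open>k \<noteq> 0\<close> unfolding ps q by (simp add: power2_eq_square eq_fract algebra_simps)
    also have "(g * h)\<^sup>2 + k\<^sup>2 * (\<Sum>p\<leftarrow>ps. p\<^sup>2) = (\<Sum>p\<leftarrow>(g * h) # map ((*) k) ps. p\<^sup>2)"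
      by (simp add: o_def power_mult_distrib sum_list_const_mult)
    finally show ?case
      using h k prime by blast
  qed
  then obtain h ps where "h \<notin> P" "Fract (h\<^sup>2 * f) 1 = Fract (\<Sum>p\<leftarrow>ps. p\<^sup>2) 1"
    unfolding f[symmetric] by auto
  then show ?thesis
    using that by (simp add: eq_fract)
qed

section \<open>Multipliers that turn the polynomial into a sum of squares\<close>

text \<open>
  The polynomial \<open>f\<close> in terms of \<open>u = x\<^sup>2\<close>, \<open>v = y\<^sup>2\<close> and \<open>w = z\<^sup>2 + 1\<close>.  The name is that of
  the forms which arise from the inequality between the arithmetic and the geometric mean.
\<close>

definition agiform :: "'a::comm_ring_1 \<Rightarrow> 'a \<Rightarrow> 'a \<Rightarrow> 'a" where
  "agiform u v w = u ^ 5 + u * v ^ 3 + w ^ 3 - 3 * u\<^sup>2 * v * w"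

text \<open>
  For \<open>a = u\<^bsup>5/3\<^esup>\<close>, \<open>b = u\<^bsup>1/3\<^esup> v\<close>, \<open>c = w\<close>, the next three identities are
  \<open>(c\<^sup>2 + a b) (a\<^sup>3 + b\<^sup>3 + c\<^sup>3 - 3 a b c) = c (c\<^sup>2 - a b)\<^sup>2 + a (b\<^sup>2 - a c)\<^sup>2 + b (a\<^sup>2 - b c)\<^sup>2\<close>
  and its images under cyclic permutation; the second and third are divided by \<open>u\<^bsup>1/3\<^esup>\<close> and
  \<open>u\<^bsup>2/3\<^esup>\<close>.
\<close>

lemma multiplier_identity_w:
  "(w\<^sup>2 + u\<^sup>2 * v) * agiform u v w =
     w * (w\<^sup>2 - u\<^sup>2 * v)\<^sup>2 + u ^ 3 * (w * u - v\<^sup>2)\<^sup>2 + u * v * (w * v - u ^ 3)\<^sup>2"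
  unfolding agiform_def by (simp add: algebra_simps eval_nat_numeral)

lemma multiplier_identity_x:
  "(u ^ 3 + v * w) * agiform u v w =
     u\<^sup>2 * (w * v - u ^ 3)\<^sup>2 + v * (w\<^sup>2 - u\<^sup>2 * v)\<^sup>2 + u * w * (w * u - v\<^sup>2)\<^sup>2"
  unfolding agiform_def by (simp add: algebra_simps eval_nat_numeral)

lemma multiplier_identity_y:
  "(v\<^sup>2 + u * w) * agiform u v w =
     u * v * (w * u - v\<^sup>2)\<^sup>2 + w * (w * v - u ^ 3)\<^sup>2 + u * (w\<^sup>2 - u\<^sup>2 * v)\<^sup>2"
  unfolding agiform_def by (simp add: algebra_simps eval_nat_numeral)

text \<open>
  Put \<open>r = x\<^sup>2 y\<close>.  In \<open>f = w\<^sup>3 - 3 w r\<^sup>2 + x\<^sup>2 (x\<^sup>8 + y\<^sup>6)\<close>, any \<open>p\<close> and \<open>q\<close> satisfy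
  \<open>(p\<^sup>2 + q\<^sup>2) (x\<^sup>8 + y\<^sup>6) = (p x\<^sup>4 + q y\<^sup>3)\<^sup>2 + (q x\<^sup>4 + p y\<^sup>3)\<^sup>2 - 4 p q x\<^sup>4 y\<^sup>3\<close>, and
  \<open>x\<^sup>2 \<cdot> x\<^sup>4 y\<^sup>3 = r\<^sup>3\<close>.  So the multiplier \<open>p\<^sup>2 + q\<^sup>2\<close> works as soon as
  \<open>(p\<^sup>2 + q\<^sup>2) (w\<^sup>3 - 3 w r\<^sup>2) - 4 p q r\<^sup>3\<close> is a sum of squares.  The choice \<open>p = w\<close>, \<open>q = - r\<close>
  gives \<open>w (w\<^sup>2 - r\<^sup>2)\<^sup>2\<close> and the first multiplier again; the choice
  \<open>p = w\<^sup>2 - 4 r\<^sup>2\<close>, \<open>q = 3 w r\<close> gives \<open>w\<^sup>3 (w\<^sup>2 - r\<^sup>2)\<^sup>2\<close> and a multiplier that is nonzero where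
  \<open>w\<^sup>2 + r\<^sup>2 = 0\<close> and \<open>r \<noteq> 0\<close>.
\<close>

lemma multiplier_identity_mixed:
  "(w ^ 4 + w\<^sup>2 * u\<^sup>2 * v + 16 * u ^ 4 * v\<^sup>2) * agiform u v w =
     w ^ 3 * (w\<^sup>2 - u\<^sup>2 * v)\<^sup>2
     + u * ((w\<^sup>2 - 4 * u\<^sup>2 * v) * u\<^sup>2 + 3 * w * u * v\<^sup>2)\<^sup>2
     + u * v * ((w\<^sup>2 - 4 * u\<^sup>2 * v) * v + 3 * w * u ^ 3)\<^sup>2"
  unfolding agiform_def by (simp add: algebra_simps eval_nat_numeral)

section \<open>Substitution into polynomials in three variables\<close>

definition ring_homo :: "('a::comm_ring_1 \<Rightarrow> 'b::comm_ring_1) \<Rightarrow> bool" where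
  "ring_homo h \<longleftrightarrow> h 1 = 1 \<and> (\<forall>a b. h (a + b) = h a + h b) \<and> (\<forall>a b. h (a * b) = h a * h b)"

lemma ring_homo_simps:
  assumes "ring_homo h"
  shows "h 1 = 1" "h (a + b) = h a + h b" "h (a * b) = h a * h b" "h 0 = 0"
    "h (- a) = - h a" "h (a - b) = h a - h b" "h (a ^ n) = h a ^ n" "h (numeral k) = numeral k"
    "h (\<Sum>q\<leftarrow>qs. q\<^sup>2) = (\<Sum>q\<leftarrow>qs. (h q)\<^sup>2)"
proof -
  show 1: "h 1 = 1" and add: "h (a + b) = h a + h b" and mult: "h (a * b) = h a * h b" for a b
    using assms unfolding ring_homo_def by auto
  show 0: "h 0 = 0"
    using add[of 0 0] by simp
  show minus: "h (- a) = - h a" for a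
    using add[of a "- a"] 0 by (simp add: eq_neg_iff_add_eq_0 add.commute)
  show "h (a - b) = h a - h b"
    using add[of a "- b"] minus[of b] by simp
  show power: "h (a ^ n) = h a ^ n" for a n
    by (induction n) (simp_all add: 1 mult)
  have "h (of_nat m) = of_nat m" for m
    by (induction m) (simp_all add: 0 1 add)
  from this[of "numeral k"] show "h (numeral k) = numeral k"
    by simp
  show "h (\<Sum>q\<leftarrow>qs. q\<^sup>2) = (\<Sum>q\<leftarrow>qs. (h q)\<^sup>2)"
    by (induction qs) (simp_all add: 0 add power)
qed

definition poly_hom :: "('a::comm_ring_1 \<Rightarrow> 'b::comm_ring_1) \<Rightarrow> 'b \<Rightarrow> 'a poly \<Rightarrow> 'b" where
  "poly_hom h a p = poly (map_poly h p) a"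

lemma poly_hom_0 [simp]: "poly_hom h a 0 = 0"
  by (simp add: poly_hom_def)

lemma poly_hom_pCons:
  "ring_homo h \<Longrightarrow> poly_hom h a (pCons c p) = h c + a * poly_hom h a p"
  by (simp add: poly_hom_def map_poly_pCons ring_homo_simps)

lemma ring_homo_poly_hom:
  assumes h: "ring_homo h"
  shows "ring_homo (poly_hom h a)"
proof -
  note simps = poly_hom_pCons[OF h] ring_homo_simps[OF h]
  have add: "poly_hom h a (p + q) = poly_hom h a p + poly_hom h a q" for p q
    by (induction p q rule: poly_induct2) (simp_all add: simps algebra_simps)
  have smult: "poly_hom h a (smult c p) = h c * poly_hom h a p" for c p
    by (induction p) (simp_all add: simps algebra_simps)
  have "poly_hom h a (p * q) = poly_hom h a p * poly_hom h a q" for p q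
    by (induction p) (simp_all add: simps add smult algebra_simps)
  moreover have "poly_hom h a 1 = 1"
    by (simp add: one_pCons simps)
  ultimately show ?thesis
    using add unfolding ring_homo_def by blast
qed

lemma poly_hom_comp:
  assumes "ring_homo h" "ring_homo k"
  shows "k (poly_hom h a p) = poly_hom (k \<circ> h) (k a) p"
proof -
  have "ring_homo (k \<circ> h)" using assms by (simp add: ring_homo_def)
  then show ?thesis
    by (induction p) (simp_all add: poly_hom_pCons assms ring_homo_simps)
qed

lemma poly_hom_comp_fun:
  "ring_homo h \<Longrightarrow> ring_homo k \<Longrightarrow> k \<circ> poly_hom h a = poly_hom (k \<circ> h) (k a)"
  by (rule ext) (simp add: poly_hom_comp)

lemma poly_hom_pcompose:
  assumes "ring_homo h"
  shows "poly_hom h a (pcompose p q) = poly_hom h (poly_hom h a q) p"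
  by (induction p)
     (simp_all add: pcompose_pCons poly_hom_pCons assms ring_homo_simps[OF ring_homo_poly_hom[OF assms]])

text \<open>
  Evaluation of a polynomial in three variables, where \<open>h\<close> embeds the real scalars in the target
  ring.  Real points, parametrized curves, the line \<open>x = y = 0\<close> and the complex point of \<open>\<mm>\<close>
  are all instances, and \<open>subst_xyz_comp\<close> below relates them.
\<close>

definition subst_xyz :: "(real \<Rightarrow> 'a::comm_ring_1) \<Rightarrow> 'a \<Rightarrow> 'a \<Rightarrow> 'a \<Rightarrow> poly_xyz \<Rightarrow> 'a" where
  "subst_xyz h a b c = poly_hom (poly_hom (poly_hom h a) b) c"

lemma ring_homo_subst: "ring_homo h \<Longrightarrow> ring_homo (subst_xyz h a b c)"
  by (simp add: subst_xyz_def ring_homo_poly_hom)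

lemma subst_xyz_var:
  assumes "ring_homo h"
  shows "subst_xyz h a b c var_x = a" "subst_xyz h a b c var_y = b" "subst_xyz h a b c var_z = c"
    "subst_xyz h a b c [:[:[:r:]:]:] = h r"
  using assms
  by (simp_all add: subst_xyz_def var_x_def var_y_def var_z_def poly_hom_pCons ring_homo_poly_hom
       ring_homo_simps)

lemma subst_xyz_comp:
  assumes "ring_homo h" "ring_homo k"
  shows "k (subst_xyz h a b c g) = subst_xyz (k \<circ> h) (k a) (k b) (k c) g"
proof -
  note comp = poly_hom_comp_fun[OF _ assms(2)]
  show ?thesis
    by (simp add: subst_xyz_def poly_hom_comp assms ring_homo_poly_hom comp)
qed

lemma ring_homo_id: "ring_homo (\<lambda>r. r)"
  and ring_homo_const: "ring_homo (\<lambda>r. [:r:])"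
  and ring_homo_of_real: "ring_homo (of_real :: real \<Rightarrow> complex)"
  and ring_homo_poly: "ring_homo (\<lambda>p. poly p a)"
  by (simp_all add: ring_homo_def one_pCons)

lemma eval_xyz_conv_subst: "eval_xyz g a b c = subst_xyz (\<lambda>r. r) a b c g"
proof -
  have 1: "poly p a = poly_hom (\<lambda>r. r) a p" for p and a :: real
    by (simp add: poly_hom_def)
  have 2: "poly (poly p [:b:]) a = poly_hom (poly_hom (\<lambda>r. r) a) b p" for p a and b :: real
    by (induction p) (simp_all add: poly_hom_pCons ring_homo_poly 1[symmetric])
  show ?thesis
    unfolding eval_xyz_def subst_xyz_def
    by (induction g) (simp_all add: poly_hom_pCons ring_homo_poly_hom ring_homo_id 2)
qed

lemma eval_xyz_subst:
  "eval_xyz g (poly p t) (poly q t) (poly r t) = poly (subst_xyz (\<lambda>c. [:c:]) p q r g) t"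
proof -
  have "(\<lambda>p. poly p t) \<circ> (\<lambda>c. [:c:]) = (\<lambda>r. r)" by auto
  then show ?thesis
    using subst_xyz_comp[OF ring_homo_const ring_homo_poly[of t], of p q r g]
    by (simp add: eval_xyz_conv_subst)
qed

section \<open>The maximal ideal of a pair of conjugate complex points\<close>

lemma ring_of_type_algebra_simps:
  "carrier (ring_of_type_algebra :: 'a::comm_ring_1 ring) = UNIV"
  "a \<otimes>\<^bsub>ring_of_type_algebra\<^esub> b = a * b" "a \<oplus>\<^bsub>ring_of_type_algebra\<^esub> b = a + b"
  "\<one>\<^bsub>ring_of_type_algebra\<^esub> = 1" "\<zero>\<^bsub>ring_of_type_algebra\<^esub> = 0"
  by (simp_all add: ring_of_type_algebra_def)

lemma ideal_type_algebraD:
  fixes I :: "'a::comm_ring_1 set"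
  assumes "ideal I ring_of_type_algebra"
  shows "0 \<in> I" "a \<in> I \<Longrightarrow> b \<in> I \<Longrightarrow> a + b \<in> I" "a \<in> I \<Longrightarrow> a * c \<in> I"
    "a \<in> I \<Longrightarrow> c * a \<in> I" "a \<in> I \<Longrightarrow> b \<in> I \<Longrightarrow> a - b \<in> I"
proof -
  interpret ideal I "ring_of_type_algebra" by fact
  show "0 \<in> I"
    using additive_subgroup.zero_closed[OF additive_subgroup_axioms]
    by (simp add: ring_of_type_algebra_simps)
  show add: "a + b \<in> I" if "a \<in> I" "b \<in> I" for a b
    using additive_subgroup.a_closed[OF additive_subgroup_axioms that]
    by (simp add: ring_of_type_algebra_simps)
  show "a * c \<in> I" if "a \<in> I" for a c
    using I_r_closed[OF that] by (simp add: ring_of_type_algebra_simps)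
  show l: "c * a \<in> I" if "a \<in> I" for a c
    using I_l_closed[OF that] by (simp add: ring_of_type_algebra_simps)
  show "a - b \<in> I" if "a \<in> I" "b \<in> I" for a b
    using add[OF that(1) l[OF that(2), of "-1"]] by simp
qed

lemma ideal_kernel:
  fixes h :: "'a::comm_ring_1 \<Rightarrow> 'b::comm_ring_1"
  assumes h: "ring_homo h"
  shows "ideal {a. h a = 0} ring_of_type_algebra"
proof (rule idealI)
  show "ring (ring_of_type_algebra :: 'a ring)" by (rule ring_from_type_algebra)
  then interpret R: ring "ring_of_type_algebra :: 'a ring" .
  have neg: "\<ominus>\<^bsub>ring_of_type_algebra\<^esub> a = - a" for a :: 'a
    by (rule R.minus_equality) (simp_all add: ring_of_type_algebra_simps)
  show "subgroup {a. h a = 0} (add_monoid ring_of_type_algebra)"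
  proof (rule subgroup.intro)
    fix a assume "a \<in> {a. h a = 0}"
    then show "inv\<^bsub>add_monoid ring_of_type_algebra\<^esub> a \<in> {a. h a = 0}"
      unfolding a_inv_def[symmetric] neg by (simp add: ring_homo_simps[OF h])
  qed (simp_all add: ring_of_type_algebra_simps ring_homo_simps[OF h])
qed (simp_all add: ring_of_type_algebra_simps ring_homo_simps[OF h])

lemma primeideal_type_algebraD:
  fixes P :: "'a::comm_ring_1 set"
  assumes "primeideal P ring_of_type_algebra"
  shows "ideal P ring_of_type_algebra" "1 \<notin> P" "a * b \<in> P \<Longrightarrow> a \<in> P \<or> b \<in> P"
proof -
  interpret primeideal P ring_of_type_algebra by fact
  show I: "ideal P ring_of_type_algebra" by (rule is_ideal)
  show "1 \<notin> P"
    using I_notcarr ideal_type_algebraD(4)[OF I, of 1] by (auto simp: ring_of_type_algebra_simps)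
  show "a * b \<in> P \<Longrightarrow> a \<in> P \<or> b \<in> P"
    using I_prime by (simp add: ring_of_type_algebra_simps)
qed

lemma primeideal_type_algebra_powerD:
  fixes P :: "'a::comm_ring_1 set"
  assumes "primeideal P ring_of_type_algebra" "a ^ n \<in> P"
  shows "a \<in> P"
  using assms(2)
  by (induction n)
     (auto simp: primeideal_type_algebraD(2)[OF assms(1)] dest!: primeideal_type_algebraD(3)[OF assms(1)])

definition at_m :: "poly_xyz \<Rightarrow> complex" where
  "at_m = subst_xyz of_real 0 0 \<i>"

lemma ring_homo_at_m: "ring_homo at_m"
  by (simp add: at_m_def ring_homo_subst ring_homo_of_real)

lemma ideal_ideal_m: "ideal ideal_m ring_xyz"
  and generators_ideal_m: "{var_x, var_y, var_z\<^sup>2 + 1} \<subseteq> ideal_m"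
  and ideal_m_least: "ideal I ring_xyz \<Longrightarrow> {var_x, var_y, var_z\<^sup>2 + 1} \<subseteq> I \<Longrightarrow> ideal_m \<subseteq> I"
proof -
  interpret ring ring_xyz by (rule ring_from_type_algebra)
  show "ideal ideal_m ring_xyz" "{var_x, var_y, var_z\<^sup>2 + 1} \<subseteq> ideal_m"
    unfolding ideal_m_def
    by (intro genideal_ideal genideal_self; simp add: ring_of_type_algebra_simps)+
  show "ideal I ring_xyz \<Longrightarrow> {var_x, var_y, var_z\<^sup>2 + 1} \<subseteq> I \<Longrightarrow> ideal_m \<subseteq> I"
    unfolding ideal_m_def by (rule genideal_minimal)
qed

text \<open>
  The residue ring of \<open>\<mm>\<close> is spanned over the reals by \<open>1\<close> and \<open>z\<close>, because \<open>z\<^sup>2\<close> is congruent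
  to \<open>-1\<close>.
\<close>

lemma linear_remainder_mod_m:
  "\<exists>a b. g - ([:[:[:a:]:]:] + [:[:[:b:]:]:] * var_z) \<in> ideal_m"
proof (induction g)
  case 0
  show ?case
    by (intro exI[of _ 0]) (simp add: ideal_type_algebraD[OF ideal_ideal_m])
next
  case (pCons c g)
  then obtain a b where ab: "g - ([:[:[:a:]:]:] + [:[:[:b:]:]:] * var_z) \<in> ideal_m" by blast
  obtain d e where c: "c = pCons d e" by (cases c)
  obtain r s where d: "d = pCons r s" by (cases d)
  \<comment> \<open>Modulo \<open>\<mm>\<close>, \<open>c + z g\<close> is \<open>r + z (a + b z)\<close>, which is \<open>(r - b) + a z\<close>.\<close>
  have "pCons c g = [:[:[:r:]:]:] + var_x * [:[:s:]:] + var_y * [:e:] + var_z * g"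
    by (simp add: c d var_x_def var_y_def var_z_def)
  moreover have "[:[:[:r - b:]:]:] = [:[:[:r:]:]:] - [:[:[:b:]:]:]" by simp
  ultimately have "pCons c g - ([:[:[:r - b:]:]:] + [:[:[:a:]:]:] * var_z)
      = var_x * [:[:s:]:] + var_y * [:e:]
        + var_z * (g - ([:[:[:a:]:]:] + [:[:[:b:]:]:] * var_z)) + [:[:[:b:]:]:] * (var_z\<^sup>2 + 1)"
    by (simp only: power2_eq_square algebra_simps mult_1_right)
  also have "\<dots> \<in> ideal_m"
    using generators_ideal_m ab
    by (blast intro: ideal_type_algebraD(2)[OF ideal_ideal_m] ideal_type_algebraD(3)[OF ideal_ideal_m]
          ideal_type_algebraD(4)[OF ideal_ideal_m])
  finally show ?case by blast
qed

text \<open>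
  So \<open>\<mm>\<close> is the vanishing ideal of the complex point \<open>(0, 0, \<i>)\<close>: on a linear remainder
  \<open>a + b z\<close> the value \<open>a + b \<i>\<close> determines both coefficients.
\<close>

lemma ideal_m_conv_at_m: "g \<in> ideal_m \<longleftrightarrow> at_m g = 0"
proof
  have vanish: "at_m g = 0" if "g \<in> ideal_m" for g
  proof -
    have "{var_x, var_y, var_z\<^sup>2 + 1} \<subseteq> {g. at_m g = 0}"
      by (simp add: ring_homo_simps[OF ring_homo_at_m])
         (simp add: at_m_def subst_xyz_var ring_homo_of_real)
    then show ?thesis
      using ideal_m_least[OF ideal_kernel[OF ring_homo_at_m]] that by blast
  qed
  then show "g \<in> ideal_m \<Longrightarrow> at_m g = 0" .
  assume "at_m g = 0"
  obtain a b where ab: "g - ([:[:[:a:]:]:] + [:[:[:b:]:]:] * var_z) \<in> ideal_m"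
    using linear_remainder_mod_m by blast
  then have "at_m (g - ([:[:[:a:]:]:] + [:[:[:b:]:]:] * var_z)) = 0"
    by (rule vanish)
  then have "of_real a + of_real b * \<i> = 0"
    using \<open>at_m g = 0\<close>
    by (simp only: ring_homo_simps[OF ring_homo_at_m])
       (simp add: at_m_def subst_xyz_var ring_homo_of_real complex_eq_iff)
  then have "a = 0" "b = 0" by (auto simp: complex_eq_iff)
  then show "g \<in> ideal_m" using ab by simp
qed

text \<open>
  Maximality of \<open>\<mm>\<close>: an element \<open>a + b z\<close> of \<open>P\<close> has the norm
  \<open>(a + b z) (a - b z) + b\<^sup>2 (z\<^sup>2 + 1) = a\<^sup>2 + b\<^sup>2\<close>, a real number in \<open>P\<close>, which must be zero.
\<close>

lemma primeideal_containing_generators: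
  assumes "primeideal P ring_xyz" "var_x \<in> P" "var_y \<in> P" "var_z\<^sup>2 + 1 \<in> P"
  shows "P = ideal_m"
proof
  note P = primeideal_type_algebraD[OF assms(1)]
  show sub: "ideal_m \<subseteq> P"
    using assms by (intro ideal_m_least P(1)) auto
  show "P \<subseteq> ideal_m"
  proof
    fix g assume "g \<in> P"
    have conjugate_product: "(p + q * z) * (p - q * z) + q\<^sup>2 * (z\<^sup>2 + 1) = p\<^sup>2 + q\<^sup>2"
      for p q z :: poly_xyz
      by (simp add: algebra_simps power2_eq_square)
    obtain a b where ab: "g - ([:[:[:a:]:]:] + [:[:[:b:]:]:] * var_z) \<in> ideal_m"
      using linear_remainder_mod_m by blast
    then have "[:[:[:a:]:]:] + [:[:[:b:]:]:] * var_z \<in> P" (is "?l \<in> P")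
      using ideal_type_algebraD(5)[OF P(1) \<open>g \<in> P\<close>] sub by force
    then have "?l * ([:[:[:a:]:]:] - [:[:[:b:]:]:] * var_z) + [:[:[:b:]:]:]\<^sup>2 * (var_z\<^sup>2 + 1) \<in> P"
      using assms(4)
      by (blast intro: ideal_type_algebraD(2)[OF P(1)] ideal_type_algebraD(3)[OF P(1)]
            ideal_type_algebraD(4)[OF P(1)])
    also have "?l * ([:[:[:a:]:]:] - [:[:[:b:]:]:] * var_z) + [:[:[:b:]:]:]\<^sup>2 * (var_z\<^sup>2 + 1)
        = [:[:[:a:]:]:]\<^sup>2 + [:[:[:b:]:]:]\<^sup>2"
      by (rule conjugate_product)
    also have "\<dots> = [:[:[:a\<^sup>2 + b\<^sup>2:]:]:]"
      by (simp add: power2_eq_square)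
    finally have "[:[:[:a\<^sup>2 + b\<^sup>2:]:]:] * [:[:[:inverse (a\<^sup>2 + b\<^sup>2):]:]:] \<in> P"
      by (rule ideal_type_algebraD(3)[OF P(1)])
    then have "a\<^sup>2 + b\<^sup>2 = 0"
      using P(2) by (cases "a\<^sup>2 + b\<^sup>2 = 0") (simp_all add: one_pCons[symmetric])
    then show "g \<in> ideal_m"
      using ab by (simp add: sum_power2_eq_zero_iff)
  qed
qed

section \<open>Sums of squares away from the maximal ideal\<close>

lemma poly_f_agiform: "poly_f = agiform (var_x\<^sup>2) (var_y\<^sup>2) (var_z\<^sup>2 + 1)"
  unfolding poly_f_def agiform_def by (simp add: power_mult[symmetric] mult.assoc)

lemma agiform_hom: "ring_homo h \<Longrightarrow> h (agiform u v w) = agiform (h u) (h v) (h w)"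
  by (simp add: agiform_def ring_homo_simps)

lemma eval_poly_f: "eval_xyz poly_f a b c = agiform (a\<^sup>2) (b\<^sup>2) (c\<^sup>2 + 1)"
  by (simp only: eval_xyz_conv_subst poly_f_agiform agiform_hom ring_homo_subst ring_homo_id
        ring_homo_simps[OF ring_homo_subst] subst_xyz_var)

text \<open>
  The multiplier \<open>w\<^sup>2 + u\<^sup>2 v\<close> is strictly positive at real points because \<open>w \<ge> 1\<close>.
\<close>

lemma psd_poly_f: "psd poly_f"
  unfolding psd_def
proof (intro allI)
  fix a b c :: real
  define w where "w = c\<^sup>2 + 1"
  have "w > 0" unfolding w_def by (simp add: add_nonneg_pos)
  have "0 \<le> (w\<^sup>2 + (a\<^sup>2)\<^sup>2 * b\<^sup>2) * agiform (a\<^sup>2) (b\<^sup>2) w"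
    unfolding multiplier_identity_w using \<open>w > 0\<close> by simp
  moreover have "w\<^sup>2 + (a\<^sup>2)\<^sup>2 * b\<^sup>2 > 0"
    using \<open>w > 0\<close> by (simp add: add_pos_nonneg)
  ultimately show "eval_xyz poly_f a b c \<ge> 0"
    unfolding eval_poly_f w_def by (simp add: zero_le_mult_iff)
qed

text \<open>
  If \<open>f\<close> were not a sum of squares in the localization, all four multipliers would lie in \<open>P\<close>.
  Modulo \<open>w\<^sup>2 + u\<^sup>2 v\<close> the last one is \<open>16 u\<^sup>4 v\<^sup>2\<close>, so \<open>u\<close> or \<open>v\<close> is in \<open>P\<close>; the first multiplier
  then yields \<open>w\<close>, and the other two yield \<open>u\<close> and \<open>v\<close>.
\<close>

lemma poly_f_sum_of_squares_off_m:
  assumes "primeideal P ring_xyz" "P \<noteq> ideal_m"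
  shows "sum_of_squares_in (localization P) (Fract poly_f 1)"
proof (rule ccontr)
  assume no: "\<not> ?thesis"
  define u v w where "u = var_x\<^sup>2" and "v = var_y\<^sup>2" and "w = var_z\<^sup>2 + 1"
  have f: "poly_f = agiform u v w"
    by (simp add: poly_f_agiform u_def v_def w_def)
  have sos: "sum_of_squares_in UNIV u" "sum_of_squares_in UNIV v" "sum_of_squares_in UNIV w"
    unfolding u_def v_def w_def
    by (auto intro: sum_of_squares_square sum_of_squares_add sum_of_squares_1)
  note sos_intros = sum_of_squares_add sum_of_squares_mult sum_of_squares_square
    sum_of_squares_power[where n = 3] sum_of_squares_power[where n = 4] sum_of_squares_numeral sos
  note P = primeideal_type_algebraD[OF assms(1)]
  note I = ideal_type_algebraD[OF P(1)]
  have mem: "s \<in> P" if "sum_of_squares_in UNIV s" "sum_of_squares_in UNIV (s * poly_f)" for s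
    using no sum_of_squares_in_localization[OF I(1) _ that] by blast
  have s1: "w\<^sup>2 + u\<^sup>2 * v \<in> P"
    by (rule mem, intro sos_intros) (unfold f multiplier_identity_w, intro sos_intros)
  have s2: "u ^ 3 + v * w \<in> P"
    by (rule mem, intro sos_intros) (unfold f multiplier_identity_x, intro sos_intros)
  have s3: "v\<^sup>2 + u * w \<in> P"
    by (rule mem, intro sos_intros) (unfold f multiplier_identity_y, intro sos_intros)
  have s4: "w ^ 4 + w\<^sup>2 * u\<^sup>2 * v + 16 * u ^ 4 * v\<^sup>2 \<in> P"
    by (rule mem, intro sos_intros) (unfold f multiplier_identity_mixed, intro sos_intros)
  have prime_power: "a \<in> P" if "a ^ n \<in> P" for a n
    using primeideal_type_algebra_powerD[OF assms(1) that] .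
  have "16 * u ^ 4 * v\<^sup>2 \<in> P"
    using I(5)[OF s4 I(4)[OF s1, of "w\<^sup>2"]] by (simp add: algebra_simps eval_nat_numeral)
  have "[:[:[:inverse 16:]:]:] * (16 * u ^ 4 * v\<^sup>2) \<in> P"
    by (rule I(4)) fact
  also have "[:[:[:inverse 16:]:]:] * (16 * u ^ 4 * v\<^sup>2) = u ^ 4 * v\<^sup>2"
    by (simp add: numeral_poly one_pCons[symmetric])
  finally have uv: "u \<in> P \<or> v \<in> P"
    using P(3) prime_power by blast
  then have "u\<^sup>2 * v \<in> P"
    using I(3,4) by (auto simp: power2_eq_square)
  then have "w\<^sup>2 \<in> P"
    using I(5)[OF s1] by force
  then have w: "w \<in> P" by (rule prime_power)
  have "u ^ 3 \<in> P" using I(5)[OF s2 I(4)[OF w, of v]] by simp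
  then have u: "u \<in> P" by (rule prime_power)
  have "v\<^sup>2 \<in> P" using I(5)[OF s3 I(4)[OF w, of u]] by simp
  then have v: "v \<in> P" by (rule prime_power)
  have "P = ideal_m"
    using primeideal_containing_generators[OF assms(1)] prime_power u v w
    unfolding u_def v_def w_def by blast
  then show False using assms(2) by blast
qed

section \<open>Vanishing on the real zeros and the obstruction\<close>

text \<open>
  Every polynomial is \<open>A(x, y, z\<^sup>2 + 1) + z B(x, y, z\<^sup>2 + 1)\<close>.  If it vanishes at \<open>(x, y, \<plusminus>z)\<close> with
  \<open>z \<noteq> 0\<close>, then \<open>A\<close> and \<open>B\<close> vanish at \<open>(x, y, z\<^sup>2 + 1)\<close>.  On the zeros of \<open>f\<close>, where
  \<open>z = \<plusminus>\<close> the square root of \<open>t\<^sup>1\<^sup>0 - 1\<close>, this leaves only arguments that are polynomials in \<open>t\<close>.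
\<close>

lemma split_z:
  "\<exists>A B. g = pcompose A [:1, 0, 1:] + var_z * pcompose B [:1, 0, 1:]"
proof (induction g)
  case 0
  show ?case by (intro exI[of _ 0]) simp
next
  case (pCons c g)
  then obtain A B where AB: "g = pcompose A [:1, 0, 1:] + var_z * pcompose B [:1, 0, 1:]" by blast
  \<comment> \<open>From \<open>c + z (A + z B)\<close>, with \<open>z\<^sup>2\<close> written as \<open>w - 1\<close>.\<close>
  have "pCons c g = [:c:] + var_z * g" by (simp add: var_z_def)
  also have "\<dots> = pcompose (pCons c B - B) [:1, 0, 1:] + var_z * pcompose A [:1, 0, 1:]"
    unfolding AB by (simp add: pcompose_pCons pcompose_diff var_z_def algebra_simps)
  finally show ?case by blast
qed

lemma subst_xyz_split_z:
  assumes "ring_homo h"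
  shows "subst_xyz h a b c (pcompose A [:1, 0, 1:] + var_z * pcompose B [:1, 0, 1:])
    = subst_xyz h a b (c\<^sup>2 + 1) A + c * subst_xyz h a b (c\<^sup>2 + 1) B"
proof -
  define h' where "h' = poly_hom (poly_hom h a) b"
  have h': "ring_homo h'" by (simp add: h'_def ring_homo_poly_hom assms)
  have "poly_hom h' c [:1, 0, 1:] = c\<^sup>2 + 1"
    by (simp add: poly_hom_pCons h' ring_homo_simps[OF h'] power2_eq_square)
  then have "subst_xyz h a b c (pcompose g [:1, 0, 1:]) = subst_xyz h a b (c\<^sup>2 + 1) g" for g
    by (simp add: subst_xyz_def poly_hom_pcompose h' flip: h'_def)
  then show ?thesis
    by (simp add: ring_homo_simps[OF ring_homo_subst[OF assms]] subst_xyz_var assms)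
qed

lemma coeff_poly_hom_monom_3:
  assumes "\<not> 3 dvd n"
  shows "coeff (poly_hom (\<lambda>c. [:c:]) (monom 1 3) p) n = 0"
  using assms
proof (induction p arbitrary: n)
  case (pCons a p)
  have "\<not> 3 dvd (n - 3)" if "n \<ge> 3"
    using pCons.prems that by (metis dvd_diffD1 dvd_refl dvd_diffD)
  moreover have "n \<noteq> 0" using pCons.prems by (metis dvd_0_right)
  ultimately show ?case
    using pCons.IH[of "n - 3"]
    by (auto simp: poly_hom_pCons ring_homo_const coeff_monom_mult coeff_pCons split: nat.splits)
qed simp

text \<open>
  The substitution \<open>(x, y, w) = (t\<^sup>3, e t\<^sup>4, t\<^sup>1\<^sup>0)\<close> sends \<open>x\<^sup>i y\<^sup>j w\<^sup>k\<close> to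
  \<open>e\<^sup>j t\<^bsup>3i + 4j + 10k\<^esup>\<close>.  The exponent 0 comes from the constant term alone, and the exponent 10
  only from \<open>w\<close> and \<open>x\<^sup>2 y\<close>, with coefficients \<open>1\<close> and \<open>e\<close>.  Taking both signs \<open>e = \<plusminus>1\<close> separates
  the latter two, so the coefficients of \<open>1\<close> and \<open>w\<close> in \<open>A\<close> are zero and \<open>A(0, 0, w)\<close> is divisible
  by \<open>w\<^sup>2\<close>.
\<close>

lemma axis_order_of_vanishing_on_curves:
  fixes A :: poly_xyz
  defines "\<alpha> \<equiv> \<lambda>e. subst_xyz (\<lambda>c. [:c:]) (monom 1 3) (monom e 4) (monom 1 10) A"
  assumes "\<alpha> 1 = 0" "\<alpha> (-1) = 0"
  shows "\<exists>k. subst_xyz (\<lambda>c. [:c:]) 0 0 w A = w\<^sup>2 * k"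
proof -
  define S1 where "S1 = poly_hom (\<lambda>c. [:c:]) (monom 1 3 :: real poly)"
  define S2 where "S2 e = poly_hom S1 (monom e 4)" for e
  define S3 where "S3 e = poly_hom (S2 e) (monom 1 10)" for e
  have \<alpha>: "\<alpha> e = S3 e A" for e
    by (simp add: \<alpha>_def S1_def S2_def S3_def subst_xyz_def)
  have hom: "ring_homo S1" "ring_homo (S2 e)" for e
    by (simp_all add: S1_def S2_def ring_homo_poly_hom ring_homo_const)
  obtain c0 c1 A' where A: "A = pCons c0 (pCons c1 A')" by (metis pCons_cases)
  obtain d0 d1 c' where c0: "c0 = pCons d0 (pCons d1 c')" by (metis pCons_cases)
  have S2_pCons: "S2 e (pCons d p) = S1 d + monom e 4 * S2 e p" for e d p
    by (simp add: S2_def poly_hom_pCons hom)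
  have S1_0: "coeff (S1 p) 0 = coeff p 0" for p
    by (cases p) (simp add: S1_def poly_hom_pCons ring_homo_const coeff_monom_mult)
  have S2_small: "coeff (S2 e p) n = coeff (S1 (coeff p 0)) n" if "n < 4" for e p n
    using that by (cases p) (simp add: S2_def poly_hom_pCons hom coeff_monom_mult)
  \<comment> \<open>The coefficients that \<open>x\<^sup>i\<close> or \<open>x\<^sup>i y\<^sup>2\<close> could contribute to \<open>t\<^sup>1\<^sup>0\<close>.\<close>
  have S1_zero: "coeff (S1 p) 10 = 0" "coeff (S1 p) 2 = 0" for p
    by (simp_all add: S1_def coeff_poly_hom_monom_3)
  have "coeff (\<alpha> e) 0 = coeff (coeff c0 0) 0" for e
    unfolding \<alpha> A S3_def
    by (simp add: poly_hom_pCons hom coeff_monom_mult S2_small S1_0)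
  then have 0: "coeff (coeff c0 0) 0 = 0"
    using assms(2) by (metis coeff_0)
  have "coeff (\<alpha> e) 10 = e * coeff (S1 d1) 6 + coeff (coeff c1 0) 0" for e
  proof -
    have "coeff (\<alpha> e) 10 = coeff (S2 e c0) 10 + coeff (S2 e c1) 0"
      unfolding \<alpha> A S3_def by (simp add: poly_hom_pCons hom coeff_monom_mult)
    also have "coeff (S2 e c0) 10 = e * coeff (S1 d1) 6"
      unfolding c0 by (simp add: S2_pCons coeff_monom_mult S1_zero S2_small)
    finally show ?thesis by (simp add: S2_small S1_0)
  qed
  from this[of 1] this[of "-1"] have 1: "coeff (coeff c1 0) 0 = 0"
    using assms(2,3) by simp
  define T where "T = poly_hom (poly_hom (\<lambda>c. [:c:]) (0 :: real poly)) 0"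
  have T: "T c = [:coeff (coeff c 0) 0:]" for c
    unfolding T_def
    by (cases c; cases "coeff c 0") (simp add: poly_hom_pCons ring_homo_poly_hom ring_homo_const)
  have "subst_xyz (\<lambda>c. [:c:]) 0 0 w A = w\<^sup>2 * poly_hom T w A'"
    unfolding subst_xyz_def T_def[symmetric] A
    by (simp add: poly_hom_pCons T_def ring_homo_poly_hom ring_homo_const)
       (simp add: T 0 1 power2_eq_square flip: T_def)
  then show ?thesis by blast
qed

text \<open>
  The real zeros used are \<open>(t\<^sup>3, e t\<^sup>4, d)\<close> with \<open>t > 1\<close>, \<open>e = \<plusminus>1\<close> and \<open>d\<^sup>2 = t\<^sup>1\<^sup>0 - 1\<close>: there
  \<open>u\<^sup>5 = u v\<^sup>3 = w\<^sup>3 = t\<^sup>3\<^sup>0\<close>.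
\<close>

lemma axis_order_of_vanishing_on_zeros:
  assumes "\<And>a b c. eval_xyz poly_f a b c = 0 \<Longrightarrow> eval_xyz q a b c = 0"
  shows "\<exists>k. subst_xyz (\<lambda>c. [:c:]) 0 0 [:0, 1:] q = [:1, 0, 1:]\<^sup>2 * k"
proof -
  obtain A B where q: "q = pcompose A [:1, 0, 1:] + var_z * pcompose B [:1, 0, 1:]"
    using split_z by blast
  note at = subst_xyz_split_z[of _ _ _ _ A B, folded q]
  define \<alpha> where
    "\<alpha> e g = subst_xyz (\<lambda>c. [:c:]) (monom 1 3) (monom e 4) (monom 1 10) g" for e :: real and g
  have "poly (\<alpha> e A) t = 0 \<and> poly (\<alpha> e B) t = 0" if "t > 1" "e\<^sup>2 = 1" for e t
  proof -
    define c where "c = sqrt (t ^ 10 - 1)"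
    have "t ^ 10 > 1" using \<open>t > 1\<close> by simp
    then have c: "c > 0" "c\<^sup>2 = t ^ 10 - 1" by (simp_all add: c_def)
    have e4: "(e * t ^ 4)\<^sup>2 = t ^ 8" using \<open>e\<^sup>2 = 1\<close> by (simp add: power_mult_distrib)
    have \<alpha>: "subst_xyz (\<lambda>r. r) (t ^ 3) (e * t ^ 4) (t ^ 10) g = poly (\<alpha> e g) t" for g
      using eval_xyz_subst[of g "monom 1 3" t "monom e 4" "monom 1 10"]
      by (simp add: \<alpha>_def eval_xyz_conv_subst poly_monom)
    have "poly (\<alpha> e A) t + d * poly (\<alpha> e B) t = 0" if "d\<^sup>2 = t ^ 10 - 1" for d
    proof -
      have "eval_xyz poly_f (t ^ 3) (e * t ^ 4) d = 0"
        unfolding eval_poly_f e4 that agiform_def by (simp add: power_mult[symmetric] power_add[symmetric])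
      then have "eval_xyz q (t ^ 3) (e * t ^ 4) d = 0" by (rule assms)
      then show ?thesis
        by (simp add: eval_xyz_conv_subst at ring_homo_id that \<alpha>)
    qed
    from this[of c] this[of "- c"] show ?thesis using c by auto
  qed
  then have "{1<..} \<subseteq> {t. poly (\<alpha> e A) t = 0}" "{1<..} \<subseteq> {t. poly (\<alpha> e B) t = 0}" if "e\<^sup>2 = 1" for e
    using that by auto
  then have "\<alpha> e A = 0" "\<alpha> e B = 0" if "e\<^sup>2 = 1" for e
    using that infinite_Ioi[of "1::real"] poly_roots_finite finite_subset by metis+
  then obtain k l where "subst_xyz (\<lambda>c. [:c:]) 0 0 [:1, 0, 1:] A = [:1, 0, 1:]\<^sup>2 * k"
    "subst_xyz (\<lambda>c. [:c:]) 0 0 [:1, 0, 1:] B = [:1, 0, 1:]\<^sup>2 * l"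
    using axis_order_of_vanishing_on_curves[of A "[:1, 0, 1:]"] axis_order_of_vanishing_on_curves[of B "[:1, 0, 1:]"]
    unfolding \<alpha>_def by auto
  moreover have "[:0, 1:]\<^sup>2 + 1 = [:1, 0, 1 :: real:]"
    by (simp add: power2_eq_square one_pCons)
  ultimately have "subst_xyz (\<lambda>c. [:c:]) 0 0 [:0, 1:] q = [:1, 0, 1:]\<^sup>2 * (k + [:0, 1:] * l)"
    by (simp only: at ring_homo_const) (simp only: distrib_left mult.left_commute)
  then show ?thesis by blast
qed

lemma poly_f_not_sum_of_squares_at_m:
  "\<not> sum_of_squares_in (localization ideal_m) (Fract poly_f 1)"
proof
  assume "sum_of_squares_in (localization ideal_m) (Fract poly_f 1)"
  then obtain h qs where h: "h \<notin> ideal_m" and qs: "h\<^sup>2 * poly_f = (\<Sum>q\<leftarrow>qs. q\<^sup>2)"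
    by (rule clear_denominators[rotated 3])
       (auto simp: ideal_m_conv_at_m ring_homo_simps[OF ring_homo_at_m])
  define axis where "axis = subst_xyz (\<lambda>c. [:c:]) 0 0 [:0, 1 :: real:]"
  define w where "w = [:1, 0, 1 :: real:]"
  have hom: "ring_homo axis" by (simp add: axis_def ring_homo_subst ring_homo_const)
  note axis_simps = ring_homo_simps[OF hom]
  have w: "[:0, 1:]\<^sup>2 + 1 = w" "w \<noteq> 0"
    by (simp_all add: w_def power2_eq_square one_pCons)
  have axis_f: "axis poly_f = w ^ 3"
    by (simp only: poly_f_agiform agiform_hom[OF hom] axis_simps)
       (simp add: axis_def subst_xyz_var ring_homo_const w agiform_def)
  have "\<exists>k. axis q = w\<^sup>2 * k" if "q \<in> set qs" for q
    unfolding axis_def w_def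
  proof (rule axis_order_of_vanishing_on_zeros)
    fix a b c assume zero: "eval_xyz poly_f a b c = 0"
    define ev where "ev = subst_xyz (\<lambda>r. r) a b c"
    have ev: "ring_homo ev" by (simp add: ev_def ring_homo_subst ring_homo_id)
    have ev_f: "ev poly_f = 0" using zero by (simp add: eval_xyz_conv_subst ev_def)
    have "(\<Sum>q\<leftarrow>qs. (ev q)\<^sup>2) = ev (h\<^sup>2 * poly_f)"
      unfolding qs ring_homo_simps[OF ev] ..
    also have "\<dots> = 0"
      by (simp add: ring_homo_simps[OF ev] ev_f)
    finally have "(ev q)\<^sup>2 = 0"
      using that by (subst (asm) sum_list_nonneg_eq_0_iff) auto
    then show "eval_xyz q a b c = 0"
      by (simp add: eval_xyz_conv_subst ev_def)
  qed
  then have "w ^ 4 dvd (axis q)\<^sup>2" if "q \<in> set qs" for q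
    using that by (fastforce simp: power_mult_distrib power_mult[symmetric])
  then have "w ^ 4 dvd (\<Sum>q\<leftarrow>qs. (axis q)\<^sup>2)"
    by (induction qs) auto
  also have "(\<Sum>q\<leftarrow>qs. (axis q)\<^sup>2) = axis (h\<^sup>2 * poly_f)"
    unfolding qs axis_simps ..
  also have "\<dots> = w ^ 3 * (axis h)\<^sup>2"
    by (simp add: axis_simps axis_f mult.commute)
  finally have "w ^ 3 * w dvd w ^ 3 * (axis h)\<^sup>2"
    by (simp add: eval_nat_numeral ac_simps)
  then obtain k where k: "(axis h)\<^sup>2 = w * k"
    using w(2) by (auto simp: elim: dvdE)
  define at_i :: "real poly \<Rightarrow> complex" where "at_i = poly_hom of_real \<i>"
  have at_i: "ring_homo at_i" by (simp add: at_i_def ring_homo_poly_hom ring_homo_of_real)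
  have "at_i w = 0"
    by (simp add: at_i_def w_def poly_hom_pCons ring_homo_of_real)
  then have "(at_i (axis h))\<^sup>2 = 0"
    using arg_cong[OF k, of at_i] by (simp add: ring_homo_simps[OF at_i])
  moreover have "at_i (axis h) = at_m h"
  proof -
    have "at_i \<circ> (\<lambda>c. [:c:]) = of_real" "at_i [:0, 1:] = \<i>"
      by (auto simp: at_i_def poly_hom_pCons ring_homo_of_real)
    then show ?thesis
      unfolding axis_def at_m_def
      using subst_xyz_comp[OF ring_homo_const at_i, of 0 0 "[:0, 1:]" h]
      by (simp add: ring_homo_simps[OF at_i])
  qed
  ultimately show False
    using h by (simp add: ideal_m_conv_at_m)
qed

theorem theorem3p6:
  shows "psd poly_f
    \<and> (\<forall>P. primeideal P ring_xyz \<and> P \<noteq> ideal_m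
          \<longrightarrow> sum_of_squares_in (localization P) (Fract poly_f 1))
    \<and> \<not> sum_of_squares_in (localization ideal_m) (Fract poly_f 1)"
  using psd_poly_f poly_f_sum_of_squares_off_m poly_f_not_sum_of_squares_at_m by blast

end
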